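(* Let $q=p^k$ for some prime $p$ and some integer $k>0$. Let $Q,R,S$ be integers each of the form $p^i$ for some integer $i\ge 0$ (the exponents may differ), and let $r=Q+R+S$. Let $m\ge 3$ be an integer with $q\equiv 1\pmod m$ or $q\equiv -1\pmod m$, let $v$ be a primitive $m$-th root of unity in $\mathbb{F}_{q^2}$, and put $b:=(1-v^4)/(v^3-v)$. Let $f(X):=X^rB(X^{q-1})$, regarded as a function $\mathbb{F}_{q^2}\to\mathbb{F}_{q^2}$. (A) Suppose that one of the following holds: (A1) $B(X):=X^{Q+R+S}-X^Q-X^R-X^S+b$ and $(Q,R,S)\equiv\pm(1,1,1)\pmod m$; (A2) $B(X):=X^{Q+R}-X^{Q+S}-X^{R+S}+bX^S-1$ and $(Q,R,S)\equiv\pm(1,1,-1)\pmod m$. Then: - if $q\equiv 1\pmod m$, then $f(X)$ is $\mathbb{F}_q$-linearly equivalent to the function $x\mapsto x^{Q+R+S}$ on $\mathbb{F}_{q^2}$; - if $q\equiv -1\pmod m$, then $f(X)$ is $\mathbb{F}_q$-linearly equivalent to the function $(x,y)\mapsto(x^{Q+R+S},y^{Q+R+S})$ on $\mathbb{F}_q\times\mathbb{F}_q$. (B) Suppose that one of the following holds: (B1) $B(X):=X^{Q+R}-X^{Q+S}-X^{R+S}+bX^S-1$ and $(Q,R,S)\equiv\pm(1,1,1)\pmod m$; (B2) $B(X):=X^{R+S}-X^{Q+R}-X^{Q+S}+bX^Q-1$ and $(Q,R,S)\equiv\pm(1,-1,1)\pmod m$; (B3) $B(X):=X^{Q+R+S}-X^Q-X^R-X^S+b$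 and $(Q,R,S)\equiv\pm(1,1,-1)\pmod m$. Then: - if $q\equiv 1\pmod m$, then $f(X)$ is $\mathbb{F}_q$-linearly equivalent to the function $x\mapsto x^{Q+R+qS}$ on $\mathbb{F}_{q^2}$; - if $q\equiv -1\pmod m$, then $f(X)$ is $\mathbb{F}_q$-linearly equivalent to the function $(x,y)\mapsto(x^{Q+R}y^S,\,y^{Q+R}x^S)$ on $\mathbb{F}_q\times\mathbb{F}_q$.
   Context: If $U$ and $V$ are $\mathbb{F}_q$-vector spaces, a function $f\colon U\to U$ is called $\mathbb{F}_q$-linearly equivalent to a function $g\colon V\to V$ if $f=\rho\circ g\circ\eta$ for some $\mathbb{F}_q$-vector space isomorphisms $\rho\colon V\to U$ and $\eta\colon U\to V$. For integers $\epsilon_1,\epsilon_2,\epsilon_3$, the notation $(Q,R,S)\equiv\pm(\epsilon_1,\epsilon_2,\epsilon_3)\pmod m$ means that there is a single sign $s\in\{1,-1\}$ with $Q\equiv s\epsilon_1$, $R\equiv s\epsilon_2$, $S\equiv s\epsilon_3\pmod m$. *)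

theory Defs
  imports
    "HOL-Library.Cardinality"
    "HOL-Analysis.Product_Vector"
    "HOL-Computational_Algebra.Polynomial"
    "HOL-Number_Theory.Cong"
begin

text \<open>
  A vector space is given by its scalar multiplication, as in \<^locale>\<open>vector_space\<close>;
  \<^const>\<open>Vector_Spaces.linear\<close> includes the vector space axioms for both arguments.
\<close>

definition linearly_equivalent ::
  "('k::field \<Rightarrow> 'u::ab_group_add \<Rightarrow> 'u) \<Rightarrow> ('k \<Rightarrow> 'v::ab_group_add \<Rightarrow> 'v) \<Rightarrow>
   ('u \<Rightarrow> 'u) \<Rightarrow> ('v \<Rightarrow> 'v) \<Rightarrow> bool"
where
  "linearly_equivalent sU sV f g \<longleftrightarrow>
     (\<exists>\<rho> \<eta>. Vector_Spaces.linear sV sU \<rho> \<and> bij \<rho> \<and>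
            Vector_Spaces.linear sU sV \<eta> \<and> bij \<eta> \<and>
            f = \<rho> \<circ> g \<circ> \<eta>)"

definition primitive_root_of_unity :: "nat \<Rightarrow> 'a::field \<Rightarrow> bool" where
  "primitive_root_of_unity m v \<longleftrightarrow>
     0 < m \<and> v ^ m = 1 \<and> (\<forall>j. 0 < j \<and> j < m \<longrightarrow> v ^ j \<noteq> 1)"

text \<open>Congruence of triples up to one sign common to the three components.\<close>

fun cong_pm :: "int \<times> int \<times> int \<Rightarrow> int \<times> int \<times> int \<Rightarrow> int \<Rightarrow> bool" where
  "cong_pm (Q, R, S) (e1, e2, e3) m \<longleftrightarrow>
     (\<exists>s \<in> {1, -1}. [Q = s * e1] (mod m) \<and> [R = s * e2] (mod m) \<and> [S = s * e3] (mod m))"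

end

theory Submission
  imports Defs
begin

text \<open>
  Write \<open>z = x\<^sup>q\<close> for the conjugate of \<open>x\<close> over \<open>\<F>\<^sub>q\<close>. Since \<open>x x\<^sup>q\<^sup>-\<^sup>1 = z\<close>,
  the factor \<open>x\<^sup>r\<close> makes \<open>f(x)\<close> a form that is linear in each of the three vectors
  \<open>(x\<^sup>Q, z\<^sup>Q)\<close>, \<open>(x\<^sup>R, z\<^sup>R)\<close>, \<open>(x\<^sup>S, z\<^sup>S)\<close>. In all five cases it is, up to exchanging the two
  entries of one of these vectors, the symmetric form
  \<open>z\<^sub>1 z\<^sub>2 z\<^sub>3 - z\<^sub>1 x\<^sub>2 x\<^sub>3 - x\<^sub>1 z\<^sub>2 x\<^sub>3 - x\<^sub>1 x\<^sub>2 z\<^sub>3 + b x\<^sub>1 x\<^sub>2 x\<^sub>3\<close>, and the value of \<open>b\<close> is the one for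
  which this form is a combination of two products of linear forms,
  \<open>\<Prod>(x\<^sub>i + v z\<^sub>i)\<close> and \<open>\<Prod>(v x\<^sub>i + z\<^sub>i)\<close> (\<open>trilinear_form_as_two_products\<close>).

  Let \<open>y\<^sub>1 = x + c z\<close> and \<open>y\<^sub>2 = c x + z\<close>, where \<open>c = v\<close> or \<open>c = v\<^sup>-\<^sup>1\<close>. For a power \<open>e\<close> of \<open>p\<close> with
  \<open>c\<^sup>e = v\<close> one gets \<open>y\<^sub>1\<^sup>e = x\<^sup>e + v z\<^sup>e\<close> and \<open>y\<^sub>2\<^sup>e = v x\<^sup>e + z\<^sup>e\<close>, while \<open>c\<^sup>e = v\<^sup>-\<^sup>1\<close> gives the same
  two values exchanged, up to a factor \<open>v\<close>. The congruences on \<open>Q, R, S\<close> fix these signs, so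
  \<open>f(x) = g M(y\<^sub>1, y\<^sub>2) + d M(y\<^sub>2, y\<^sub>1)\<close> with \<open>M(y, y') = y\<^sup>Q\<^sup>+\<^sup>R\<^sup>+\<^sup>S\<close> in part (A) and
  \<open>M(y, y') = y\<^sup>Q\<^sup>+\<^sup>R y'\<^sup>S\<close> in part (B), where one of \<open>g, d\<close> is \<open>-v\<close> times the other.

  What remains concerns only the positions of \<open>y\<^sub>1\<close> and \<open>y\<^sub>2\<close>. If \<open>q \<equiv> 1\<close>, then \<open>c\<close> lies in
  \<open>\<F>\<^sub>q\<close>, so \<open>y\<^sub>2\<close> is the conjugate of \<open>y\<^sub>1\<close> and \<open>f\<close> is \<open>y \<mapsto> g y + d y\<^sup>q\<close> after
  \<open>y \<mapsto> M(y, y\<^sup>q)\<close> after \<open>x \<mapsto> y\<^sub>1\<close>. If \<open>q \<equiv> -1\<close>, then \<open>c\<close> has norm \<open>1\<close>, and after scaling by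
  \<open>u = 1 + c\<^sup>-\<^sup>1\<close> both \<open>y\<^sub>1\<close> and \<open>y\<^sub>2\<close> lie in \<open>\<F>\<^sub>q\<close>; they are the two coordinates of \<open>\<F>\<^sub>q \<times> \<F>\<^sub>q\<close>.
  The linear maps involved are bijective because \<open>v\<^sup>2 \<noteq> 1\<close>, which is where \<open>m \<ge> 3\<close> enters.
\<close>

section \<open>A quadratic extension of finite fields\<close>

text \<open>
  Multiplication by \<open>x \<noteq> 0\<close> permutes the nonzero elements, so it preserves their product.
\<close>

lemma power_card_eq_self:
  fixes x :: "'a::{field,finite}"
  shows "x ^ CARD('a) = x"
proof (cases "x = 0")
  case False
  let ?U = "UNIV - {0::'a}"
  have "(\<Prod>y\<in>?U. y) = (\<Prod>y\<in>?U. x * y)"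
    by (rule prod.reindex_bij_witness[of _ "\<lambda>y. x * y" "\<lambda>y. y / x"]) (use False in auto)
  then have "(\<Prod>y\<in>?U. y) = x ^ (CARD('a) - 1) * (\<Prod>y\<in>?U. y)"
    by (simp add: prod.distrib)
  moreover have "(\<Prod>y\<in>?U. y) \<noteq> 0" by simp
  ultimately have "x ^ (CARD('a) - 1) = 1"
    by simp
  then show ?thesis
    by (metis mult_1_right power_eq_if zero_less_card_finite less_irrefl)
qed simp

locale quadratic_extension =
  fixes p k q :: nat and \<iota> :: "'k::{field,finite} \<Rightarrow> 'l::{field,finite}"
  assumes prime_p: "prime p" and k_pos: "k > 0" and q_eq: "q = p ^ k"
    and card_base: "CARD('k) = q" and card_ext: "CARD('l) = q ^ 2"
    and emb_one: "\<iota> 1 = 1"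
    and emb_add: "\<And>x y. \<iota> (x + y) = \<iota> x + \<iota> y"
    and emb_mult: "\<And>x y. \<iota> (x * y) = \<iota> x * \<iota> y"
begin

lemma q_gt_1: "q > 1"
  unfolding q_eq using prime_gt_1_nat[OF prime_p] k_pos by (rule one_less_power)

lemma CHAR_ext: "CHAR('l) = p"
proof -
  have "CHAR('l) > 0" by (rule finite_imp_CHAR_pos) simp
  then have pr: "prime CHAR('l)" by (rule prime_CHAR_semidom)
  \<comment> \<open>translation by \<open>1\<close> permutes the field, so the sum of all elements absorbs \<open>CARD('l) \<cdot> 1\<close>\<close>
  have "(\<Sum>y\<in>UNIV. y :: 'l) = (\<Sum>y\<in>UNIV. y + 1)"
    by (rule sum.reindex_bij_witness[of _ "\<lambda>y. y + 1" "\<lambda>y. y - 1"]) auto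
  then have "of_nat CARD('l) = (0 :: 'l)" by (simp add: sum.distrib)
  then have "CHAR('l) dvd CARD('l)" by (simp add: of_nat_eq_0_iff_char_dvd)
  then have "CHAR('l) dvd p ^ (k * 2)"
    by (simp add: card_ext q_eq power_mult)
  then have "CHAR('l) dvd p" using pr by (rule prime_dvd_power_nat[rotated])
  with pr prime_p show ?thesis by (simp add: primes_dvd_imp_eq)
qed

lemma frobenius_add: "(x + y :: 'l) ^ (p ^ i) = x ^ (p ^ i) + y ^ (p ^ i)"
  by (rule freshmans_dream') (simp_all add: CHAR_ext prime_p)

lemma conj_add: "(x + y :: 'l) ^ q = x ^ q + y ^ q"
  by (simp add: q_eq frobenius_add)

lemma conj_minus: "(- x :: 'l) ^ q = - (x ^ q)"
proof -
  have "(- x) ^ q + x ^ q = (- x + x) ^ q" by (simp only: conj_add)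
  also have "\<dots> = 0" using q_gt_1 by simp
  finally show ?thesis by (simp add: eq_neg_iff_add_eq_0)
qed

lemma conj_diff: "(x - y :: 'l) ^ q = x ^ q - y ^ q"
  using conj_add[of x "- y"] by (simp add: conj_minus)

lemma conj_conj: "((x :: 'l) ^ q) ^ q = x"
  using power_card_eq_self[of x] by (simp add: card_ext power2_eq_square power_mult)

lemma emb_zero: "\<iota> 0 = 0"
  using emb_add[of 0 0] by (metis add_0 add_left_cancel add.right_neutral)

lemma emb_minus: "\<iota> (- a) = - \<iota> a"
  using emb_add[of a "- a"] by (simp add: emb_zero eq_neg_iff_add_eq_0 add.commute)

lemma emb_power: "\<iota> (a ^ n) = \<iota> a ^ n"
  by (induction n) (simp_all add: emb_one emb_mult)

lemma emb_eq_0_iff: "\<iota> a = 0 \<longleftrightarrow> a = 0"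
proof
  show "a = 0" if "\<iota> a = 0"
  proof (rule ccontr)
    assume "a \<noteq> 0"
    then have "\<iota> (a * inverse a) = 1" by (simp add: emb_one)
    with that show False by (simp add: emb_mult)
  qed
qed (simp add: emb_zero)

lemma inj_emb: "inj \<iota>"
proof (rule injI)
  fix a b assume "\<iota> a = \<iota> b"
  then have "\<iota> (a + - b) = 0" by (simp only: emb_add emb_minus) simp
  then show "a = b" by (simp add: emb_eq_0_iff)
qed

lemma conj_emb: "\<iota> a ^ q = \<iota> a"
  using power_card_eq_self[of a] by (simp add: card_base flip: emb_power)

text \<open>The \<open>q\<close> elements of the base field already exhaust the roots of \<open>X\<^sup>q - X\<close>.\<close>

lemma range_emb: "range \<iota> = {x. x ^ q = x}"
proof (rule card_seteq)
  let ?P = "monom 1 q - monom 1 1 :: 'l poly"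
  have "coeff ?P q = 1" using q_gt_1 by simp
  then have "?P \<noteq> 0" by (metis coeff_0 zero_neq_one)
  then have "card {x. poly ?P x = 0} \<le> degree ?P" by (rule card_poly_roots_bound)
  also have "degree ?P \<le> q"
    using q_gt_1 by (intro degree_diff_le) (simp_all add: degree_monom_le order.trans[OF degree_monom_le])
  finally show "card {x::'l. x ^ q = x} \<le> card (range \<iota>)"
    by (simp add: poly_monom card_image[OF inj_emb] card_base)
qed (auto simp: conj_emb)

lemma emb_inv: "x ^ q = x \<Longrightarrow> \<iota> (inv \<iota> x) = x"
  using range_emb by (metis (mono_tags, lifting) f_inv_into_f mem_Collect_eq)

lemma vector_space_ext: "vector_space (\<lambda>a x. \<iota> a * x)"
  by unfold_locales (simp_all add: algebra_simps emb_add emb_mult emb_one)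

lemma scale_pair: "module_prod.scale (*) (*) = (\<lambda>a (x, y). (a * x, a * y :: 'k))"
proof -
  have "vector_space ((*) :: 'k \<Rightarrow> 'k \<Rightarrow> 'k)"
    by unfold_locales (simp_all add: algebra_simps)
  then interpret vector_space_prod "(*) :: 'k \<Rightarrow> 'k \<Rightarrow> 'k" "(*) :: 'k \<Rightarrow> 'k \<Rightarrow> 'k"
    by (simp add: vector_space_prod_def vector_space_pair_def)
  show ?thesis by (auto simp: fun_eq_iff scale_def)
qed

lemma vector_space_pair: "vector_space (\<lambda>a (x, y). (a * x, a * y :: 'k))"
  by unfold_locales (auto simp: algebra_simps)

section \<open>The two equivalences for diagonal forms\<close>

text \<open>
  The determinant of \<open>x \<mapsto> a x + b x\<^sup>q\<close> over the base field is the difference of the norms of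
  \<open>a\<close> and \<open>b\<close>.
\<close>

lemma linear_conj_combination:
  assumes "a * a ^ q \<noteq> b * b ^ q"
  shows "Vector_Spaces.linear (\<lambda>a x. \<iota> a * x) (\<lambda>a x. \<iota> a * x) (\<lambda>x. a * x + b * x ^ q)"
    and "bij (\<lambda>x. a * x + b * x ^ q)"
proof -
  let ?h = "\<lambda>x. a * x + b * x ^ q"
  show lin: "Vector_Spaces.linear (\<lambda>a x. \<iota> a * x) (\<lambda>a x. \<iota> a * x) ?h"
    unfolding Vector_Spaces.linear_iff
    by (intro conjI allI vector_space_ext)
      (simp_all add: conj_add power_mult_distrib conj_emb algebra_simps)
  have "x = 0" if "?h x = 0" for x
  proof -
    have "?h x ^ q = 0" using that q_gt_1 by simp
    then have conj_eq: "a ^ q * x ^ q + b ^ q * x = 0"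
      by (simp add: conj_add power_mult_distrib conj_conj)
    have "(a * a ^ q - b * b ^ q) * x = a ^ q * ?h x - b * (a ^ q * x ^ q + b ^ q * x)"
      by (simp add: algebra_simps)
    also have "\<dots> = 0" unfolding that conj_eq by simp
    finally show ?thesis using assms by simp
  qed
  moreover have "?h (x - y) = ?h x - ?h y" for x y
    by (simp add: conj_diff algebra_simps)
  ultimately have "inj ?h"
    by (intro injI) (metis right_minus_eq)
  then show "bij ?h" by (simp add: bij_def finite_UNIV_inj_surj)
qed

text \<open>
  For \<open>c\<close> and the coefficients in the base field, the second linear form is the conjugate of the
  first, and the second monomial is the conjugate of the first.
\<close>

lemma diagonal_form_equivalent_power:
  assumes c: "c ^ q = c" "c\<^sup>2 \<noteq> 1" and g: "g ^ q = g" and d: "d ^ q = d" and gd: "g\<^sup>2 \<noteq> d\<^sup>2"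
    and f: "\<And>x. f x = g * ((x + c * x ^ q) ^ A * (c * x + x ^ q) ^ B)
                    + d * ((c * x + x ^ q) ^ A * (x + c * x ^ q) ^ B)"
  shows "linearly_equivalent (\<lambda>a x. \<iota> a * x) (\<lambda>a x. \<iota> a * x) f (\<lambda>x. x ^ (A + q * B))"
proof -
  define \<rho> where "\<rho> = (\<lambda>y. g * y + d * y ^ q)"
  define \<eta> where "\<eta> = (\<lambda>x. 1 * x + c * x ^ q)"
  have \<rho>: "Vector_Spaces.linear (\<lambda>a x. \<iota> a * x) (\<lambda>a x. \<iota> a * x) \<rho>" "bij \<rho>"
    unfolding \<rho>_def using g d gd by (intro linear_conj_combination; simp add: power2_eq_square)+
  have \<eta>: "Vector_Spaces.linear (\<lambda>a x. \<iota> a * x) (\<lambda>a x. \<iota> a * x) \<eta>" "bij \<eta>"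
    unfolding \<eta>_def using c by (intro linear_conj_combination; simp add: power2_eq_square)+
  have "f x = \<rho> (\<eta> x ^ (A + q * B))" for x
  proof -
    have y: "\<eta> x = x + c * x ^ q" by (simp add: \<eta>_def)
    have z: "\<eta> x ^ q = c * x + x ^ q"
      by (simp add: \<eta>_def conj_add power_mult_distrib conj_conj c)
    have "\<eta> x ^ (A + q * B) = \<eta> x ^ A * (\<eta> x ^ q) ^ B"
      by (simp add: power_add power_mult)
    moreover have "(\<eta> x ^ A * (\<eta> x ^ q) ^ B) ^ q = (\<eta> x ^ q) ^ A * \<eta> x ^ B"
    proof -
      have "(\<eta> x ^ A * (\<eta> x ^ q) ^ B) ^ q = (\<eta> x ^ q) ^ A * ((\<eta> x ^ q) ^ q) ^ B"
        by (simp only: power_mult_distrib power_mult[symmetric] mult.commute mult.left_commute)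
      then show ?thesis by (simp only: conj_conj)
    qed
    ultimately show ?thesis
      by (simp only: f \<rho>_def z) (simp only: y)
  qed
  then have "f = \<rho> \<circ> (\<lambda>x. x ^ (A + q * B)) \<circ> \<eta>" by (simp add: fun_eq_iff)
  with \<rho> \<eta> show ?thesis unfolding linearly_equivalent_def by blast
qed

text \<open>
  For \<open>c\<close> of norm \<open>1\<close>, multiplication by \<open>u = 1 + c\<^sup>q\<close> moves both linear forms into the base field,
  because \<open>u\<^sup>q = c u\<close>; the factor \<open>u\<close> is nonzero as \<open>c \<noteq> -1\<close>. The condition on the coefficients
  says that they form a basis over the base field.
\<close>

lemma diagonal_form_equivalent_pair:
  assumes c: "c * c ^ q = 1" "c\<^sup>2 \<noteq> 1" and gd: "d ^ q * g \<noteq> d * g ^ q"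
    and f: "\<And>x. f x = g * ((x + c * x ^ q) ^ A * (c * x + x ^ q) ^ B)
                    + d * ((c * x + x ^ q) ^ A * (x + c * x ^ q) ^ B)"
  shows "linearly_equivalent (\<lambda>a x. \<iota> a * x) (module_prod.scale (*) (*)) f
           (\<lambda>(x, y). (x ^ A * y ^ B, y ^ A * x ^ B))"
proof -
  define u where "u = 1 + c ^ q"
  have c0: "c \<noteq> 0" using c by auto
  have u0: "u \<noteq> 0"
  proof
    assume "u = 0"
    then have "c ^ q = - 1" by (simp add: u_def add_eq_0_iff)
    with c(1) have "c = - 1" by (metis minus_minus mult_minus1_right)
    with c(2) show False by simp
  qed
  have uq: "u ^ q = c * u"
    using c(1) by (simp add: u_def conj_add conj_conj algebra_simps)
  define Y where "Y = (\<lambda>x. u * (x + c * x ^ q))"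
  define Z where "Z = (\<lambda>x. u * (c * x + x ^ q))"
  have cc: "c ^ q * c = 1" using c(1) by (simp add: mult.commute)
  have Yq: "Y x ^ q = Y x" for x
  proof -
    have "Y x ^ q = u ^ q * (x ^ q + c ^ q * x)"
      by (simp only: Y_def conj_add power_mult_distrib conj_conj)
    also have "\<dots> = u * (c * x ^ q + (c ^ q * c) * x)"
      by (simp only: uq) (simp add: algebra_simps)
    also have "\<dots> = Y x"
      unfolding cc by (simp add: Y_def algebra_simps)
    finally show ?thesis .
  qed
  have Zq: "Z x ^ q = Z x" for x
  proof -
    have "Z x ^ q = u ^ q * (c ^ q * x ^ q + x)"
      by (simp only: Z_def conj_add power_mult_distrib conj_conj)
    also have "\<dots> = u * ((c ^ q * c) * x ^ q + c * x)"
      by (simp only: uq) (simp add: algebra_simps)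
    also have "\<dots> = Z x"
      unfolding cc by (simp add: Z_def algebra_simps)
    finally show ?thesis .
  qed
  have Y_add: "Y (x + x') = Y x + Y x'" and Z_add: "Z (x + x') = Z x + Z x'" for x x'
    by (simp_all add: Y_def Z_def conj_add algebra_simps)
  have Y_scale: "Y (\<iota> a * x) = \<iota> a * Y x" and Z_scale: "Z (\<iota> a * x) = \<iota> a * Z x" for a x
    by (simp_all add: Y_def Z_def power_mult_distrib conj_emb algebra_simps)
  define \<eta> where "\<eta> = (\<lambda>x. (inv \<iota> (Y x), inv \<iota> (Z x)))"
  have \<eta>_eqI: "\<eta> x = (a, b)" if "Y x = \<iota> a" "Z x = \<iota> b" for x a b
    by (simp add: \<eta>_def that inv_f_f[OF inj_emb])
  have emb_\<eta>: "\<iota> (fst (\<eta> x)) = Y x" "\<iota> (snd (\<eta> x)) = Z x" for x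
    by (simp_all add: \<eta>_def emb_inv Yq Zq)
  define w where "w = inverse (u ^ (A + B))"
  define \<rho> where "\<rho> = (\<lambda>(a, b). w * (g * \<iota> a + d * \<iota> b))"
  have w0: "w \<noteq> 0" by (simp add: w_def u0)

  have \<eta>_lin: "Vector_Spaces.linear (\<lambda>a x. \<iota> a * x) (module_prod.scale (*) (*)) \<eta>"
    unfolding Vector_Spaces.linear_iff scale_pair
  proof (intro conjI allI)
    show "\<eta> (x + x') = \<eta> x + \<eta> x'" for x x'
      using emb_\<eta>[of x] emb_\<eta>[of x'] by (cases "\<eta> x"; cases "\<eta> x'")
        (auto intro!: \<eta>_eqI simp: Y_add Z_add emb_add)
    show "\<eta> (\<iota> a * x) = (case \<eta> x of (y, z) \<Rightarrow> (a * y, a * z))" for a x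
      using emb_\<eta>[of x] by (cases "\<eta> x")
        (auto intro!: \<eta>_eqI simp: Y_scale Z_scale emb_mult)
  qed (simp_all add: vector_space_ext vector_space_pair)
  have \<rho>_lin: "Vector_Spaces.linear (module_prod.scale (*) (*)) (\<lambda>a x. \<iota> a * x) \<rho>"
    unfolding Vector_Spaces.linear_iff scale_pair
    by (intro conjI allI vector_space_ext vector_space_pair)
      (auto simp: \<rho>_def emb_add emb_mult algebra_simps)

  have card_eq: "CARD('k \<times> 'k) = CARD('l)"
    by (simp add: card_base card_ext power2_eq_square)
  have "inj \<eta>"
  proof (rule injI)
    fix x x' assume "\<eta> x = \<eta> x'"
    then have "Y x = Y x'" "Z x = Z x'" by (simp_all flip: emb_\<eta>)
    then have e: "x + c * x ^ q = x' + c * x' ^ q" "c * x + x ^ q = c * x' + x' ^ q"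
      using u0 by (simp_all add: Y_def Z_def)
    have "(1 - c\<^sup>2) * x = (x + c * x ^ q) - c * (c * x + x ^ q)"
      by (simp add: algebra_simps power2_eq_square)
    also have "\<dots> = (1 - c\<^sup>2) * x'"
      unfolding e by (simp add: algebra_simps power2_eq_square)
    finally show "x = x'" using c(2) by simp
  qed
  then have \<eta>_bij: "bij \<eta>"
    using card_eq by (intro bij_betw_imageI) (simp_all add: card_image card_subset_eq)
  have "inj \<rho>"
  proof (rule injI, clarify)
    fix a b a' b' assume "\<rho> (a, b) = \<rho> (a', b')"
    then have e: "g * \<iota> a + d * \<iota> b = g * \<iota> a' + d * \<iota> b'" using w0 by (simp add: \<rho>_def)
    then have "(g * \<iota> a + d * \<iota> b) ^ q = (g * \<iota> a' + d * \<iota> b') ^ q" by simp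
    then have e': "g ^ q * \<iota> a + d ^ q * \<iota> b = g ^ q * \<iota> a' + d ^ q * \<iota> b'"
      by (simp add: conj_add power_mult_distrib conj_emb)
    \<comment> \<open>Cramer's rule for the system given by \<open>e\<close> and its conjugate\<close>
    have "(d ^ q * g - d * g ^ q) * \<iota> a
        = d ^ q * (g * \<iota> a + d * \<iota> b) - d * (g ^ q * \<iota> a + d ^ q * \<iota> b)"
      by (simp add: algebra_simps)
    also have "\<dots> = (d ^ q * g - d * g ^ q) * \<iota> a'"
      unfolding e e' by (simp add: algebra_simps)
    finally have "\<iota> a = \<iota> a'" using gd by simp
    have "(d ^ q * g - d * g ^ q) * \<iota> b
        = g * (g ^ q * \<iota> a + d ^ q * \<iota> b) - g ^ q * (g * \<iota> a + d * \<iota> b)"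
      by (simp add: algebra_simps)
    also have "\<dots> = (d ^ q * g - d * g ^ q) * \<iota> b'"
      unfolding e e' by (simp add: algebra_simps)
    finally have "\<iota> b = \<iota> b'" using gd by simp
    with \<open>\<iota> a = \<iota> a'\<close> show "a = a' \<and> b = b'" using inj_emb by (auto dest: injD)
  qed
  then have \<rho>_bij: "bij \<rho>"
    using card_eq by (intro bij_betw_imageI) (simp_all add: card_image card_subset_eq)

  have "f x = (\<rho> \<circ> (\<lambda>(x, y). (x ^ A * y ^ B, y ^ A * x ^ B)) \<circ> \<eta>) x" for x
  proof -
    have "(\<rho> \<circ> (\<lambda>(x, y). (x ^ A * y ^ B, y ^ A * x ^ B)) \<circ> \<eta>) x
        = w * (g * (Y x ^ A * Z x ^ B) + d * (Z x ^ A * Y x ^ B))"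
      using emb_\<eta>[of x] by (cases "\<eta> x") (simp add: \<rho>_def emb_mult emb_power)
    also have "\<dots> = (w * u ^ (A + B)) * f x"
      by (simp only: f Y_def Z_def power_mult_distrib power_add) (simp add: algebra_simps)
    finally show ?thesis by (simp add: w_def u0)
  qed
  then have "f = \<rho> \<circ> (\<lambda>(x, y). (x ^ A * y ^ B, y ^ A * x ^ B)) \<circ> \<eta>" by (rule ext)
  with \<rho>_lin \<rho>_bij \<eta>_lin \<eta>_bij show ?thesis unfolding linearly_equivalent_def by blast
qed

text \<open>
  Both cases for the coefficients that occur, in the ratio \<open>-v\<close>: the square of that ratio is not
  \<open>1\<close>, and if \<open>v\<close> has norm \<open>1\<close>, then the ratio is not in the base field.
\<close>

lemma diagonal_form_equivalent:
  assumes v: "v\<^sup>2 \<noteq> 1" and c: "c = v \<or> c = inverse v"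
    and \<kappa>: "\<kappa> \<noteq> 0" "v ^ q = v \<Longrightarrow> \<kappa> ^ q = \<kappa>"
    and gd: "g = \<kappa> \<and> d = - v * \<kappa> \<or> g = - v * \<kappa> \<and> d = \<kappa>"
    and f: "\<And>x. f x = g * ((x + c * x ^ q) ^ A * (c * x + x ^ q) ^ B)
                    + d * ((c * x + x ^ q) ^ A * (x + c * x ^ q) ^ B)"
  shows "v ^ q = v \<Longrightarrow>
      linearly_equivalent (\<lambda>a x. \<iota> a * x) (\<lambda>a x. \<iota> a * x) f (\<lambda>x. x ^ (A + q * B))"
    and "v ^ q = inverse v \<Longrightarrow> v \<noteq> 0 \<Longrightarrow>
      linearly_equivalent (\<lambda>a x. \<iota> a * x) (module_prod.scale (*) (*)) f
        (\<lambda>(x, y). (x ^ A * y ^ B, y ^ A * x ^ B))"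
proof -
  have c2: "c\<^sup>2 \<noteq> 1"
    using v c by (auto simp: power_inverse)
  {
    assume vq: "v ^ q = v"
    have "\<kappa>\<^sup>2 * 1 \<noteq> \<kappa>\<^sup>2 * v\<^sup>2" using v \<kappa>(1) by simp
    then have "g\<^sup>2 \<noteq> d\<^sup>2" using gd by (auto simp: power_mult_distrib mult.commute)
    moreover have "c ^ q = c" using c vq by (auto simp: power_inverse)
    moreover have "g ^ q = g" "d ^ q = d"
      using gd \<kappa>(2)[OF vq] vq by (auto simp: conj_minus power_mult_distrib)
    ultimately show "linearly_equivalent (\<lambda>a x. \<iota> a * x) (\<lambda>a x. \<iota> a * x) f (\<lambda>x. x ^ (A + q * B))"
      using c2 f by (intro diagonal_form_equivalent_power)
  next
    assume vq: "v ^ q = inverse v" and v0: "v \<noteq> 0"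
    have "c * c ^ q = 1" using c vq v0 by (auto simp: power_inverse)
    moreover have "d ^ q * g \<noteq> d * g ^ q"
    proof
      assume "d ^ q * g = d * g ^ q"
      then have "inverse v * (\<kappa> * \<kappa> ^ q) = v * (\<kappa> * \<kappa> ^ q)"
        using gd vq by (auto simp: conj_minus power_mult_distrib mult_ac)
      then have "inverse v = v" using \<kappa>(1) by simp
      then show False using v v0 by (metis power2_eq_square right_inverse)
    qed
    ultimately show "linearly_equivalent (\<lambda>a x. \<iota> a * x) (module_prod.scale (*) (*)) f
        (\<lambda>(x, y). (x ^ A * y ^ B, y ^ A * x ^ B))"
      using c2 f by (intro diagonal_form_equivalent_pair)
  }
qed

end

section \<open>Diagonalising the form\<close>

text \<open>
  The weights \<open>1\<close> and \<open>-v\<close> of the two products make the coefficients with two \<open>z\<close>'s cancel, and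
  the coefficient of \<open>x\<^sub>1 x\<^sub>2 x\<^sub>3\<close> then comes out as \<open>b\<close> once those of the other monomials are
  normalised.
\<close>

lemma trilinear_form_as_two_products:
  fixes v :: "'a::field"
  assumes "v ^ 3 - v \<noteq> 0" and "b = (1 - v ^ 4) / (v ^ 3 - v)"
  shows "z1 * z2 * z3 - z1 * x2 * x3 - x1 * z2 * x3 - x1 * x2 * z3 + b * (x1 * x2 * x3)
    = inverse (v ^ 3 - v) * ((x1 + v * z1) * (x2 + v * z2) * (x3 + v * z3)
        - v * ((v * x1 + z1) * (v * x2 + z2) * (v * x3 + z3)))"
    (is "?F = inverse ?D * ?P")
proof -
  have "?D * b = 1 - v ^ 4" using assms by simp
  then have "?D * b * (x1 * x2 * x3) = (1 - v ^ 4) * (x1 * x2 * x3)" by simp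
  then have "?D * ?F = ?P" by algebra
  with assms(1) show ?thesis by (simp add: field_simps)
qed

lemma power_int_cong:
  fixes v :: "'a::field"
  assumes "v ^ m = 1" "v \<noteq> 0" "[a = b] (mod int m)"
  shows "v powi a = v powi b"
proof -
  obtain j where "a = b + int m * j" using assms(3) by (metis cong_iff_lin cong_sym)
  then have "v powi a = v powi b * (v ^ m) powi j"
    using assms(2) by (simp add: power_int_add power_int_mult)
  with assms(1) show ?thesis by simp
qed

text \<open>The common sign \<open>s\<close> of the congruences is absorbed by passing from \<open>v\<close> to \<open>v\<^sup>s\<close>.\<close>

lemma root_of_unity_power_sign:
  fixes v :: "'a::field"
  assumes "v ^ m = 1" "v \<noteq> 0" "s = 1 \<or> s = - 1" "[int e = s * t] (mod int m)"
  shows "(v powi s) ^ e = v powi t"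
proof -
  have "[s * int e = s * (s * t)] (mod int m)" using assms(4) by (rule cong_scalar_left)
  moreover have "s * (s * t) = t" using assms(3) by auto
  ultimately show ?thesis
    using assms(1,2) by (simp add: power_int_power' power_int_cong)
qed

theorem theorem1p14:
  fixes p k q Q R S r m :: nat
    and \<iota> :: "'k::{field,finite} \<Rightarrow> 'l::{field,finite}"
    and v b :: 'l
    and B :: "'l poly"
    and f :: "'l \<Rightarrow> 'l"
    and sL :: "'k \<Rightarrow> 'l \<Rightarrow> 'l"
    and sKK :: "'k \<Rightarrow> 'k \<times> 'k \<Rightarrow> 'k \<times> 'k"
  assumes "prime p" and "k > 0" and q: "q = p ^ k"
    and "CARD('k) = q" and "CARD('l) = q ^ 2"
    and embedding: "\<iota> 1 = 1" "\<And>x y. \<iota> (x + y) = \<iota> x + \<iota> y" "\<And>x y. \<iota> (x * y) = \<iota> x * \<iota> y"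
    and sL: "sL = (\<lambda>c x. \<iota> c * x)"
    and sKK: "sKK = module_prod.scale (*) (*)"
    and "\<exists>i. Q = p ^ i" and "\<exists>i. R = p ^ i" and "\<exists>i. S = p ^ i"
    and r: "r = Q + R + S"
    and "m \<ge> 3"
    and "[int q = 1] (mod int m) \<or> [int q = -1] (mod int m)"
    and "primitive_root_of_unity m v"
    and b: "b = (1 - v ^ 4) / (v ^ 3 - v)"
    and f: "f = poly (monom 1 r * pcompose B (monom 1 (q - 1)))"
  shows
    "((B = monom 1 (Q + R + S) - monom 1 Q - monom 1 R - monom 1 S + [:b:] \<and>
         cong_pm (int Q, int R, int S) (1, 1, 1) (int m)
       \<or> B = monom 1 (Q + R) - monom 1 (Q + S) - monom 1 (R + S) + monom b S - 1 \<and>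
         cong_pm (int Q, int R, int S) (1, 1, -1) (int m))
      \<longrightarrow>
        ([int q = 1] (mod int m) \<longrightarrow>
           linearly_equivalent sL sL f (\<lambda>x. x ^ (Q + R + S))) \<and>
        ([int q = -1] (mod int m) \<longrightarrow>
           linearly_equivalent sL sKK f (\<lambda>(x, y). (x ^ (Q + R + S), y ^ (Q + R + S)))))
     \<and>
     ((B = monom 1 (Q + R) - monom 1 (Q + S) - monom 1 (R + S) + monom b S - 1 \<and>
         cong_pm (int Q, int R, int S) (1, 1, 1) (int m)
       \<or> B = monom 1 (R + S) - monom 1 (Q + R) - monom 1 (Q + S) + monom b Q - 1 \<and>
         cong_pm (int Q, int R, int S) (1, -1, 1) (int m)
       \<or> B = monom 1 (Q + R + S) - monom 1 Q - monom 1 R - monom 1 S + [:b:] \<and>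
         cong_pm (int Q, int R, int S) (1, 1, -1) (int m))
      \<longrightarrow>
        ([int q = 1] (mod int m) \<longrightarrow>
           linearly_equivalent sL sL f (\<lambda>x. x ^ (Q + R + q * S))) \<and>
        ([int q = -1] (mod int m) \<longrightarrow>
           linearly_equivalent sL sKK f (\<lambda>(x, y). (x ^ (Q + R) * y ^ S, y ^ (Q + R) * x ^ S))))"
proof -
  interpret quadratic_extension p k q \<iota>
    by unfold_locales (fact assms)+
  have vm: "v ^ m = 1" and vprim: "\<And>j. 0 < j \<Longrightarrow> j < m \<Longrightarrow> v ^ j \<noteq> 1"
    using \<open>primitive_root_of_unity m v\<close> by (auto simp: primitive_root_of_unity_def)
  have v0: "v \<noteq> 0" using vm \<open>m \<ge> 3\<close> by (auto simp: power_0_left)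
  have v2: "v\<^sup>2 \<noteq> 1" using vprim[of 2] \<open>m \<ge> 3\<close> by simp
  have "v ^ 3 - v = v * (v\<^sup>2 - 1)" by (simp add: algebra_simps power3_eq_cube power2_eq_square)
  then have D: "v ^ 3 - v \<noteq> 0" using v0 v2 by simp
  have q_split: "v ^ q = v" if "[int q = 1] (mod int m)"
    using root_of_unity_power_sign[OF vm v0, of 1 q 1] that by simp
  have q_nonsplit: "v ^ q = inverse v" if "[int q = -1] (mod int m)"
    using root_of_unity_power_sign[OF vm v0, of 1 q "- 1"] that by (simp add: power_int_minus)

  have frob: "(x + y) ^ Q = x ^ Q + y ^ Q" "(x + y) ^ R = x ^ R + y ^ R"
    "(x + y) ^ S = x ^ S + y ^ S" for x y :: 'l
    using \<open>\<exists>i. Q = p ^ i\<close> \<open>\<exists>i. R = p ^ i\<close> \<open>\<exists>i. S = p ^ i\<close> by (auto simp: frobenius_add)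
  have conj_split: "(x ^ q) ^ e = x ^ e * (x ^ (q - 1)) ^ e" for x :: 'l and e
    using q_gt_1 by (simp add: power_mult_distrib[symmetric] power_eq_if[of x q])
  have f_eq: "f x = x ^ (Q + R + S) * poly B (x ^ (q - 1))" for x
    by (simp add: f r poly_monom poly_pcompose)
  define N where "N = inverse (v ^ 3 - v)"
  note two_products = trilinear_form_as_two_products[OF D b, folded N_def]
  \<comment> \<open>the symmetric form, and the same form with the entries of the third or the first vector exchanged\<close>
  have f_sym: "f x =
      N * ((x ^ Q + v * (x ^ q) ^ Q) * (x ^ R + v * (x ^ q) ^ R) * (x ^ S + v * (x ^ q) ^ S)
        - v * ((v * x ^ Q + (x ^ q) ^ Q) * (v * x ^ R + (x ^ q) ^ R) * (v * x ^ S + (x ^ q) ^ S)))"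
    if "B = monom 1 (Q + R + S) - monom 1 Q - monom 1 R - monom 1 S + [:b:]" for x
    unfolding two_products[symmetric]
    by (simp add: f_eq that poly_monom conj_split power_add algebra_simps)
  have f_swapS: "f x =
      N * ((x ^ Q + v * (x ^ q) ^ Q) * (x ^ R + v * (x ^ q) ^ R) * ((x ^ q) ^ S + v * x ^ S)
        - v * ((v * x ^ Q + (x ^ q) ^ Q) * (v * x ^ R + (x ^ q) ^ R) * (v * (x ^ q) ^ S + x ^ S)))"
    if "B = monom 1 (Q + R) - monom 1 (Q + S) - monom 1 (R + S) + monom b S - 1" for x
    unfolding two_products[symmetric]
    by (simp add: f_eq that poly_monom conj_split power_add algebra_simps)
  have f_swapQ: "f x =
      N * (((x ^ q) ^ Q + v * x ^ Q) * (x ^ R + v * (x ^ q) ^ R) * (x ^ S + v * (x ^ q) ^ S)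
        - v * ((v * (x ^ q) ^ Q + x ^ Q) * (v * x ^ R + (x ^ q) ^ R) * (v * x ^ S + (x ^ q) ^ S)))"
    if "B = monom 1 (R + S) - monom 1 (Q + R) - monom 1 (Q + S) + monom b Q - 1" for x
    unfolding two_products[symmetric]
    by (simp add: f_eq that poly_monom conj_split power_add algebra_simps)

  \<comment> \<open>a factor \<open>c\<^sup>e = v\<^sup>-\<^sup>1\<close> exchanges the two linear forms, up to \<open>v\<close>\<close>
  have forms_plus: "x ^ e + v * (x ^ q) ^ e = (x + c * x ^ q) ^ e"
    "v * x ^ e + (x ^ q) ^ e = (c * x + x ^ q) ^ e"
    "(x ^ q) ^ e + v * x ^ e = (c * x + x ^ q) ^ e"
    "v * (x ^ q) ^ e + x ^ e = (x + c * x ^ q) ^ e"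
    if "c ^ e = v powi 1" "e = Q \<or> e = R \<or> e = S" for c x e
    using that by (auto simp: frob power_mult_distrib)
  have forms_minus: "x ^ e + v * (x ^ q) ^ e = v * (c * x + x ^ q) ^ e"
    "v * x ^ e + (x ^ q) ^ e = v * (x + c * x ^ q) ^ e"
    "(x ^ q) ^ e + v * x ^ e = v * (x + c * x ^ q) ^ e"
    "v * (x ^ q) ^ e + x ^ e = v * (c * x + x ^ q) ^ e"
    if "c ^ e = v powi - 1" "e = Q \<or> e = R \<or> e = S" for c x e
    using that v0
    by (auto simp: frob power_mult_distrib power_int_minus distrib_left simp flip: mult.assoc)
  have twist: "\<exists>c. (c = v \<or> c = inverse v) \<and>
      c ^ Q = v powi e1 \<and> c ^ R = v powi e2 \<and> c ^ S = v powi e3"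
    if cong: "cong_pm (int Q, int R, int S) (e1, e2, e3) (int m)" for e1 e2 e3
  proof -
    obtain s where "s \<in> {1, - 1}" and e: "[int Q = s * e1] (mod int m) \<and>
        [int R = s * e2] (mod int m) \<and> [int S = s * e3] (mod int m)"
      using cong unfolding cong_pm.simps by blast
    then have s: "s = 1 \<or> s = - 1" by simp
    note power = root_of_unity_power_sign[OF vm v0 s]
    have "(v powi s) ^ Q = v powi e1" "(v powi s) ^ R = v powi e2" "(v powi s) ^ S = v powi e3"
      using e by (simp_all only: power)
    moreover have "v powi s = v \<or> v powi s = inverse v"
      using s by (auto simp: power_int_minus)
    ultimately show ?thesis by blast
  qed

  have equivalences: "([int q = 1] (mod int m) \<longrightarrow>
        linearly_equivalent sL sL f (\<lambda>x. x ^ (A + q * A'))) \<and>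
      ([int q = -1] (mod int m) \<longrightarrow>
        linearly_equivalent sL sKK f (\<lambda>(x, y). (x ^ A * y ^ A', y ^ A * x ^ A')))"
    if "c = v \<or> c = inverse v" and "\<kappa> = N \<or> \<kappa> = v * N"
      and "g = \<kappa> \<and> d = - v * \<kappa> \<or> g = - v * \<kappa> \<and> d = \<kappa>"
      and "\<And>x. f x = g * ((x + c * x ^ q) ^ A * (c * x + x ^ q) ^ A')
                   + d * ((c * x + x ^ q) ^ A * (x + c * x ^ q) ^ A')"
    for c \<kappa> g d A A'
  proof -
    have "\<kappa> \<noteq> 0" using that(2) D v0 by (auto simp: N_def)
    have "N ^ q = N" if "v ^ q = v"
    proof -
      have "(v ^ 3) ^ q = v ^ 3" using that by (metis power_mult mult.commute)
      then show ?thesis using that by (simp add: N_def conj_diff power_inverse)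
    qed
    then have "\<kappa> ^ q = \<kappa>" if "v ^ q = v"
      using \<open>\<kappa> = N \<or> \<kappa> = v * N\<close> that by (auto simp: power_mult_distrib)
    note equiv = diagonal_form_equivalent[OF v2 that(1) \<open>\<kappa> \<noteq> 0\<close> this that(3,4)]
    show ?thesis
      unfolding sL sKK using equiv q_split q_nonsplit v0 by blast
  qed
  note equivalencesA = equivalences[where A = "Q + R + S" and A' = 0, simplified]
  note equivalencesB = equivalences[where A = "Q + R" and A' = S]

  let ?A = "([int q = 1] (mod int m) \<longrightarrow>
        linearly_equivalent sL sL f (\<lambda>x. x ^ (Q + R + S))) \<and>
      ([int q = -1] (mod int m) \<longrightarrow>
        linearly_equivalent sL sKK f (\<lambda>(x, y). (x ^ (Q + R + S), y ^ (Q + R + S))))"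
  let ?B = "([int q = 1] (mod int m) \<longrightarrow>
        linearly_equivalent sL sL f (\<lambda>x. x ^ (Q + R + q * S))) \<and>
      ([int q = -1] (mod int m) \<longrightarrow>
        linearly_equivalent sL sKK f (\<lambda>(x, y). (x ^ (Q + R) * y ^ S, y ^ (Q + R) * x ^ S)))"
  show ?thesis
  proof (rule conjI; rule impI; elim disjE conjE)
    assume B: "B = monom 1 (Q + R + S) - monom 1 Q - monom 1 R - monom 1 S + [:b:]"
      and "cong_pm (int Q, int R, int S) (1, 1, 1) (int m)"
    from twist[OF this(2)] obtain c where c: "c = v \<or> c = inverse v"
      "c ^ Q = v powi 1" "c ^ R = v powi 1" "c ^ S = v powi 1" by blast
    show "?A"
    proof (rule equivalencesA[of c N N "- v * N"], goal_cases)
      case (4 x)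
      show ?case
        by (simp only: f_sym[OF B]
            forms_plus[OF c(2)] forms_plus[OF c(3)] forms_plus[OF c(4)] simp_thms)
          (simp add: power_add algebra_simps)
    qed (simp_all add: c(1))
  next
    assume B: "B = monom 1 (Q + R) - monom 1 (Q + S) - monom 1 (R + S) + monom b S - 1"
      and "cong_pm (int Q, int R, int S) (1, 1, -1) (int m)"
    from twist[OF this(2)] obtain c where c: "c = v \<or> c = inverse v"
      "c ^ Q = v powi 1" "c ^ R = v powi 1" "c ^ S = v powi - 1" by blast
    show "?A"
    proof (rule equivalencesA[of c "v * N" "v * N" "- v * (v * N)"], goal_cases)
      case (4 x)
      show ?case
        by (simp only: f_swapS[OF B]
            forms_plus[OF c(2)] forms_plus[OF c(3)] forms_minus[OF c(4)] simp_thms)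
          (simp add: power_add algebra_simps)
    qed (simp_all add: c(1))
  next
    assume B: "B = monom 1 (Q + R) - monom 1 (Q + S) - monom 1 (R + S) + monom b S - 1"
      and "cong_pm (int Q, int R, int S) (1, 1, 1) (int m)"
    from twist[OF this(2)] obtain c where c: "c = v \<or> c = inverse v"
      "c ^ Q = v powi 1" "c ^ R = v powi 1" "c ^ S = v powi 1" by blast
    show "?B"
    proof (rule equivalencesB[of c N N "- v * N"], goal_cases)
      case (4 x)
      show ?case
        by (simp only: f_swapS[OF B]
            forms_plus[OF c(2)] forms_plus[OF c(3)] forms_plus[OF c(4)] simp_thms)
          (simp add: power_add algebra_simps)
    qed (simp_all add: c(1))
  next
    assume B: "B = monom 1 (R + S) - monom 1 (Q + R) - monom 1 (Q + S) + monom b Q - 1"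
      and "cong_pm (int Q, int R, int S) (1, -1, 1) (int m)"
    from twist[OF this(2)] obtain c where c: "c = v \<or> c = inverse v"
      "c ^ Q = v powi 1" "c ^ R = v powi - 1" "c ^ S = v powi 1" by blast
    \<comment> \<open>exchanges come from the form at \<open>Q\<close> and from \<open>c\<close> at \<open>R\<close>: the first product is \<open>M(y\<^sub>2, y\<^sub>1)\<close>\<close>
    show "?B"
    proof (rule equivalencesB[of c "v * N" "- v * (v * N)" "v * N"], goal_cases)
      case (4 x)
      show ?case
        by (simp only: f_swapQ[OF B]
            forms_plus[OF c(2)] forms_minus[OF c(3)] forms_plus[OF c(4)] simp_thms)
          (simp add: power_add algebra_simps)
    qed (simp_all add: c(1))
  next
    assume B: "B = monom 1 (Q + R + S) - monom 1 Q - monom 1 R - monom 1 S + [:b:]"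
      and "cong_pm (int Q, int R, int S) (1, 1, -1) (int m)"
    from twist[OF this(2)] obtain c where c: "c = v \<or> c = inverse v"
      "c ^ Q = v powi 1" "c ^ R = v powi 1" "c ^ S = v powi - 1" by blast
    show "?B"
    proof (rule equivalencesB[of c "v * N" "v * N" "- v * (v * N)"], goal_cases)
      case (4 x)
      show ?case
        by (simp only: f_sym[OF B]
            forms_plus[OF c(2)] forms_plus[OF c(3)] forms_minus[OF c(4)] simp_thms)
          (simp add: power_add algebra_simps)
    qed (simp_all add: c(1))
  qed
qed

end
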